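(* Let $Q=\Omega\times I$ (of finite measure), let $\delta>0$, $P_\delta(s):=\max\{s,\delta\}$, and for a raw approximation $u_\rho$ on $Q$ define $u_\rho^+:=P_\delta(u_\rho)$. Assume that the exact concentration satisfies $u^*\ge0$ a.e. in $Q$. Then, pointwise a.e. in $Q$, either $|u_\rho^+-u_\rho|\le2\delta$ or $|u_\rho^+-u^*|\le|u_\rho-u^*|$. More precisely, $$|u_\rho^+-u^*|\le|u_\rho-u^*|+\delta\,\mathbf 1_{\{-\delta\le u_\rho<\delta\}}\quad\text{a.e. in }Q.$$ Consequently, $$\|u_\rho^+-u^*\|_{L^2(Q)}\le\|u_\rho-u^*\|_{L^2(Q)}+\delta\,|\{-\delta\le u_\rho<\delta\}|^{1/2},$$ and in particular $$\|u_\rho^+-u^*\|_{L^2(Q)}\le\|u_\rho-u^*\|_{L^2(Q)}+\delta|Q|^{1/2}.$$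
   Context: $\Omega$ is a bounded spatial domain and $I$ a bounded time interval; $u_\rho,u^*$ are real-valued functions in $L^2(Q)$; $|A|$ denotes Lebesgue measure of a set $A$, $\{-\delta\le u_\rho<\delta\}$ is the subset of $Q$ where the inequality holds, and $\mathbf 1$ denotes an indicator function. *)

theory Defs
  imports "HOL-Analysis.Analysis"
begin

(* Elements of L^2(Q) are given by representatives defined on the whole type; since
   everything refers to lebesgue_on Q, only their restrictions to Q matter. *)
definition in_L2 :: "('a::euclidean_space) set \<Rightarrow> ('a \<Rightarrow> real) \<Rightarrow> bool" where
  "in_L2 Q f \<longleftrightarrow>
     f \<in> borel_measurable (lebesgue_on Q) \<and> integrable (lebesgue_on Q) (\<lambda>z. (f z)\<^sup>2)"

(* The Bochner integral of a non-integrable function is 0, so L2_norm Q f is the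
   L^2 norm only if in_L2 Q f. *)
definition L2_norm :: "('a::euclidean_space) set \<Rightarrow> ('a \<Rightarrow> real) \<Rightarrow> real" where
  "L2_norm Q f = sqrt (\<integral>z. (f z)\<^sup>2 \<partial>lebesgue_on Q)"

definition P_cut :: "real \<Rightarrow> real \<Rightarrow> real" where
  "P_cut \<delta> s = max s \<delta>"

end

theory Submission
  imports Defs
begin

text \<open>
  Everything rests on a pointwise inequality between three reals. Where \<open>u_rho \<ge> \<delta>\<close>, the cut does
  nothing. Where \<open>u_rho < - \<delta>\<close>, the raw value is at distance more than \<open>u_star + \<delta>\<close> from
  \<open>u_star \<ge> 0\<close>, whereas \<open>\<delta>\<close> is at distance at most \<open>u_star + \<delta>\<close> from it. In between, the cut moves the
  value upwards to \<open>\<delta>\<close>, by at most \<open>2 * \<delta>\<close>; the error can then grow only if \<open>u_star < \<delta>\<close>, and in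
  that case the new error \<open>\<delta> - u_star\<close> is at most \<open>\<delta>\<close> (\<open>P_cut_error_le\<close>).

  The norm estimates follow from Minkowski's inequality, with the second summand the function
  \<open>\<delta>\<close> times the indicator of the set where the raw value lies in \<open>{-\<delta>..<\<delta>}\<close>; its norm is \<open>\<delta>\<close>
  times the square root of the measure of that set. Boundedness of the cylinder makes all measures
  finite.
\<close>

lemma P_cut_moves_little_or_improves:
  assumes "0 < \<delta>" "0 \<le> v"
  shows "\<bar>P_cut \<delta> s - s\<bar> \<le> 2 * \<delta> \<or> \<bar>P_cut \<delta> s - v\<bar> \<le> \<bar>s - v\<bar>"
  using assms unfolding P_cut_def by (auto simp: max_def abs_if)

text \<open>
  Bounding the growth by the displacement \<open>\<delta> - s\<close> would only give \<open>2 * \<delta>\<close>. The constant improves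
  to \<open>\<delta>\<close> because, for \<open>v < \<delta>\<close>, the whole new error is at most \<open>\<delta>\<close>, while for \<open>v \<ge> \<delta>\<close> raising
  \<open>s\<close> to \<open>\<delta>\<close> brings it closer to \<open>v\<close>.
\<close>
lemma P_cut_error_le:
  assumes "0 < \<delta>" "0 \<le> v"
  shows "\<bar>P_cut \<delta> s - v\<bar> \<le> \<bar>s - v\<bar> + \<delta> * of_bool (- \<delta> \<le> s \<and> s < \<delta>)"
  using assms unfolding P_cut_def by (auto simp: max_def abs_if)

lemma integrable_square_add:
  fixes f g :: "'b \<Rightarrow> real"
  assumes [measurable]: "f \<in> borel_measurable M" "g \<in> borel_measurable M"
    and "integrable M (\<lambda>x. (f x)\<^sup>2)" "integrable M (\<lambda>x. (g x)\<^sup>2)"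
  shows "integrable M (\<lambda>x. (f x + g x)\<^sup>2)"
proof (rule Bochner_Integration.integrable_bound)
  show "integrable M (\<lambda>x. 2 * (f x)\<^sup>2 + 2 * (g x)\<^sup>2)"
    using assms by auto
  have "(a + b)\<^sup>2 \<le> 2 * a\<^sup>2 + 2 * b\<^sup>2" for a b :: real
    using zero_le_power2[of "a - b"] by (simp add: power2_eq_square algebra_simps)
  then show "AE x in M. norm ((f x + g x)\<^sup>2) \<le> norm (2 * (f x)\<^sup>2 + 2 * (g x)\<^sup>2)"
    by (intro AE_I2) auto
qed measurable

text \<open>
  Convexity of the square gives \<open>(a + b)\<^sup>2 \<le> (\<alpha> + \<beta>) * (a\<^sup>2 / \<alpha> + b\<^sup>2 / \<beta>)\<close> for all positive weights.
  With the norms of the two functions as weights, integration yields the square of the sum of the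
  norms.
\<close>
lemma weighted_square_add_le:
  fixes a b \<alpha> \<beta> :: real
  assumes "0 < \<alpha>" "0 < \<beta>"
  shows "(a + b)\<^sup>2 \<le> (\<alpha> + \<beta>) * (a\<^sup>2 / \<alpha> + b\<^sup>2 / \<beta>)"
proof -
  have "(\<alpha> + \<beta>) * (a\<^sup>2 / \<alpha> + b\<^sup>2 / \<beta>) - (a + b)\<^sup>2 = (\<beta> * a - \<alpha> * b)\<^sup>2 / (\<alpha> * \<beta>)"
    using assms by (simp add: field_simps power2_eq_square)
  also have "\<dots> \<ge> 0"
    using assms by simp
  finally show ?thesis by simp
qed

lemma sqrt_integral_square_add_le:
  fixes f g :: "'b \<Rightarrow> real"
  assumes f: "f \<in> borel_measurable M" "integrable M (\<lambda>x. (f x)\<^sup>2)"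
    and g: "g \<in> borel_measurable M" "integrable M (\<lambda>x. (g x)\<^sup>2)"
  shows "sqrt (\<integral>x. (f x + g x)\<^sup>2 \<partial>M) \<le> sqrt (\<integral>x. (f x)\<^sup>2 \<partial>M) + sqrt (\<integral>x. (g x)\<^sup>2 \<partial>M)"
proof (rule field_le_epsilon)
  fix e :: real assume "0 < e"
  define A where "A = sqrt (\<integral>x. (f x)\<^sup>2 \<partial>M)"
  define B where "B = sqrt (\<integral>x. (g x)\<^sup>2 \<partial>M)"
  have A: "0 \<le> A" "(\<integral>x. (f x)\<^sup>2 \<partial>M) = A\<^sup>2" and B: "0 \<le> B" "(\<integral>x. (g x)\<^sup>2 \<partial>M) = B\<^sup>2"
    by (auto simp: A_def B_def)
  \<comment> \<open>A norm may vanish, so both weights are shifted to be positive.\<close>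
  define \<alpha> where "\<alpha> = A + e / 2"
  define \<beta> where "\<beta> = B + e / 2"
  have pos: "0 < \<alpha>" "0 < \<beta>" and le: "A \<le> \<alpha>" "B \<le> \<beta>"
    using A B \<open>0 < e\<close> by (auto simp: \<alpha>_def \<beta>_def)
  have "(\<integral>x. (f x + g x)\<^sup>2 \<partial>M) \<le> (\<integral>x. (\<alpha> + \<beta>) * ((f x)\<^sup>2 / \<alpha> + (g x)\<^sup>2 / \<beta>) \<partial>M)"
    using f g pos by (intro integral_mono integrable_square_add weighted_square_add_le) auto
  also have "\<dots> = (\<alpha> + \<beta>) * (A\<^sup>2 / \<alpha> + B\<^sup>2 / \<beta>)"
    using f g by (simp add: A B)
  also have "\<dots> \<le> (\<alpha> + \<beta>) * (\<alpha> + \<beta>)"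
  proof -
    have "A\<^sup>2 / \<alpha> \<le> \<alpha>" "B\<^sup>2 / \<beta> \<le> \<beta>"
      using A B pos le by (auto simp: divide_le_eq power2_eq_square intro: mult_mono)
    then show ?thesis
      using pos by (intro mult_left_mono) auto
  qed
  finally have "sqrt (\<integral>x. (f x + g x)\<^sup>2 \<partial>M) \<le> \<alpha> + \<beta>"
    using pos by (intro real_le_lsqrt) (auto simp: power2_eq_square)
  also have "\<alpha> + \<beta> = A + B + e"
    by (simp add: \<alpha>_def \<beta>_def)
  finally show "sqrt (\<integral>x. (f x + g x)\<^sup>2 \<partial>M)
      \<le> sqrt (\<integral>x. (f x)\<^sup>2 \<partial>M) + sqrt (\<integral>x. (g x)\<^sup>2 \<partial>M) + e"
    by (simp add: A_def B_def)
qed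

lemma lmeasurable_cylinder:
  fixes \<Omega> :: "('a::euclidean_space) set" and I :: "real set"
  assumes "open \<Omega>" "bounded \<Omega>" "is_interval I" "bounded I"
  shows "\<Omega> \<times> I \<in> lmeasurable"
proof -
  have "I \<in> sets borel"
    using \<open>is_interval I\<close> by (rule real_interval_borel_measurable)
  then have "\<Omega> \<times> I \<in> sets (borel \<Otimes>\<^sub>M borel)"
    using \<open>open \<Omega>\<close> by auto
  then have "\<Omega> \<times> I \<in> sets lebesgue"
    by (intro sets_completionI_sets) (simp only: borel_prod sets_lborel)
  then show ?thesis
    using assms by (intro bounded_set_imp_lmeasurable bounded_Times)
qed

lemma in_L2_diff:
  assumes "in_L2 Q f" "in_L2 Q g"
  shows "in_L2 Q (\<lambda>z. f z - g z)"
  using assms integrable_square_add[of f "lebesgue_on Q" "\<lambda>z. - g z"]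
  unfolding in_L2_def by auto

lemma in_L2_P_cut:
  assumes "Q \<in> lmeasurable" "in_L2 Q u"
  shows "in_L2 Q (\<lambda>z. P_cut \<delta> (u z))"
proof -
  have [measurable]: "u \<in> borel_measurable (lebesgue_on Q)"
    and int: "integrable (lebesgue_on Q) (\<lambda>z. (u z)\<^sup>2)"
    using assms by (auto simp: in_L2_def)
  interpret finite_measure "lebesgue_on Q"
    using assms by (intro finite_measure_lebesgue_on)
  have "integrable (lebesgue_on Q) (\<lambda>z. (P_cut \<delta> (u z))\<^sup>2)"
  proof (rule Bochner_Integration.integrable_bound)
    show "integrable (lebesgue_on Q) (\<lambda>z. (u z)\<^sup>2 + \<delta>\<^sup>2)"
      using int by auto
    show "AE z in lebesgue_on Q. norm ((P_cut \<delta> (u z))\<^sup>2) \<le> norm ((u z)\<^sup>2 + \<delta>\<^sup>2)"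
      by (intro AE_I2) (auto simp: P_cut_def max_def)
  qed (simp add: P_cut_def)
  then show ?thesis
    by (simp add: in_L2_def P_cut_def)
qed

lemma L2_norm_indicator:
  assumes "Q \<in> sets lebesgue" "S \<subseteq> Q" "S \<in> sets (lebesgue_on Q)" "0 \<le> c"
  shows "L2_norm Q (\<lambda>z. c * indicator S z) = c * sqrt (measure lebesgue S)"
proof -
  have "(\<integral>z. (c * indicator S z)\<^sup>2 \<partial>lebesgue_on Q) = (\<integral>z. c\<^sup>2 * indicator S z \<partial>lebesgue_on Q)"
    by (intro Bochner_Integration.integral_cong) (auto simp: indicator_def)
  also have "\<dots> = c\<^sup>2 * measure (lebesgue_on Q) S"
    using assms by (simp add: Int_absorb2)
  also have "measure (lebesgue_on Q) S = measure lebesgue S"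
    using assms by (intro measure_restrict_space) auto
  finally show ?thesis
    using assms by (simp add: L2_norm_def real_sqrt_mult)
qed

lemma L2_norm_le_add:
  assumes L2: "in_L2 Q f" "in_L2 Q g" "in_L2 Q h"
    and le: "AE z in lebesgue_on Q. \<bar>h z\<bar> \<le> \<bar>f z\<bar> + g z"
  shows "L2_norm Q h \<le> L2_norm Q f + L2_norm Q g"
proof -
  let ?M = "lebesgue_on Q"
  have f: "(\<lambda>z. \<bar>f z\<bar>) \<in> borel_measurable ?M" "integrable ?M (\<lambda>z. \<bar>f z\<bar>\<^sup>2)"
    and g: "g \<in> borel_measurable ?M" "integrable ?M (\<lambda>z. (g z)\<^sup>2)"
    and h: "integrable ?M (\<lambda>z. (h z)\<^sup>2)"
    using L2 by (auto simp: in_L2_def)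
  have "AE z in ?M. (h z)\<^sup>2 \<le> (\<bar>f z\<bar> + g z)\<^sup>2"
    using le by eventually_elim (auto simp: abs_le_square_iff[symmetric])
  then have "(\<integral>z. (h z)\<^sup>2 \<partial>?M) \<le> (\<integral>z. (\<bar>f z\<bar> + g z)\<^sup>2 \<partial>?M)"
    by (intro integral_mono_AE integrable_square_add f g h)
  then have "L2_norm Q h \<le> sqrt (\<integral>z. (\<bar>f z\<bar> + g z)\<^sup>2 \<partial>?M)"
    by (simp add: L2_norm_def)
  also have "\<dots> \<le> sqrt (\<integral>z. \<bar>f z\<bar>\<^sup>2 \<partial>?M) + sqrt (\<integral>z. (g z)\<^sup>2 \<partial>?M)"
    by (intro sqrt_integral_square_add_le f g)
  finally show ?thesis
    by (simp add: L2_norm_def)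
qed

theorem proposition3p13:
  fixes \<Omega> :: "('a::euclidean_space) set" and I :: "real set"
    and Q :: "('a \<times> real) set"
    and \<delta> :: real
    and u_rho u_plus u_star :: "'a \<times> real \<Rightarrow> real"
  assumes "open \<Omega>" and "connected \<Omega>" and "\<Omega> \<noteq> {}" and "bounded \<Omega>"
    and "is_interval I" and "bounded I"
    and "Q = \<Omega> \<times> I"
    and "\<delta> > 0"
    and "in_L2 Q u_rho" and "in_L2 Q u_star"
    and "u_plus = (\<lambda>z. P_cut \<delta> (u_rho z))"
    and "AE z in lebesgue_on Q. u_star z \<ge> 0"
  shows
    "(AE z in lebesgue_on Q.
        \<bar>u_plus z - u_rho z\<bar> \<le> 2 * \<delta> \<or> \<bar>u_plus z - u_star z\<bar> \<le> \<bar>u_rho z - u_star z\<bar>)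
   \<and> (AE z in lebesgue_on Q.
        \<bar>u_plus z - u_star z\<bar> \<le> \<bar>u_rho z - u_star z\<bar>
          + \<delta> * indicator {z \<in> Q. - \<delta> \<le> u_rho z \<and> u_rho z < \<delta>} z)
   \<and> in_L2 Q u_plus
   \<and> L2_norm Q (\<lambda>z. u_plus z - u_star z)
       \<le> L2_norm Q (\<lambda>z. u_rho z - u_star z)
         + \<delta> * sqrt (measure lebesgue {z \<in> Q. - \<delta> \<le> u_rho z \<and> u_rho z < \<delta>})
   \<and> L2_norm Q (\<lambda>z. u_plus z - u_star z)
       \<le> L2_norm Q (\<lambda>z. u_rho z - u_star z) + \<delta> * sqrt (measure lebesgue Q)"
proof -
  let ?M = "lebesgue_on Q"
  define S where "S = {z \<in> Q. - \<delta> \<le> u_rho z \<and> u_rho z < \<delta>}"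
  note \<delta> = \<open>\<delta> > 0\<close> and u_plus = \<open>u_plus = (\<lambda>z. P_cut \<delta> (u_rho z))\<close>
  have Q: "Q \<in> lmeasurable"
    unfolding \<open>Q = \<Omega> \<times> I\<close> by (intro lmeasurable_cylinder assms)
  have [measurable]: "u_rho \<in> borel_measurable ?M"
    using \<open>in_L2 Q u_rho\<close> by (simp add: in_L2_def)
  have S: "S \<in> sets ?M" "S \<subseteq> Q"
  proof -
    have "{z \<in> space ?M. - \<delta> \<le> u_rho z \<and> u_rho z < \<delta>} \<in> sets ?M"
      by measurable
    then show "S \<in> sets ?M" by (simp add: S_def)
  qed (auto simp: S_def)
  have S_leb: "S \<in> sets lebesgue"
    using S Q by (simp add: sets_restrict_space_iff fmeasurableD)
  have dichotomy: "AE z in ?M.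
      \<bar>u_plus z - u_rho z\<bar> \<le> 2 * \<delta> \<or> \<bar>u_plus z - u_star z\<bar> \<le> \<bar>u_rho z - u_star z\<bar>"
    using \<open>AE z in ?M. u_star z \<ge> 0\<close>
    by eventually_elim (use \<delta> P_cut_moves_little_or_improves in \<open>simp add: u_plus\<close>)
  have error: "AE z in ?M. \<bar>u_plus z - u_star z\<bar> \<le> \<bar>u_rho z - u_star z\<bar> + \<delta> * indicator S z"
    using \<open>AE z in ?M. u_star z \<ge> 0\<close> AE_space
  proof eventually_elim
    case (elim z)
    then have "indicator S z = (of_bool (- \<delta> \<le> u_rho z \<and> u_rho z < \<delta>) :: real)"
      by (auto simp: S_def indicator_def)
    then show ?case
      using P_cut_error_le[OF \<delta> elim(1)] by (simp add: u_plus)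
  qed
  have plus: "in_L2 Q u_plus"
    unfolding u_plus by (intro in_L2_P_cut Q assms)
  have indicator: "in_L2 Q (\<lambda>z. \<delta> * indicator S z)"
  proof -
    interpret finite_measure ?M
      using Q by (intro finite_measure_lebesgue_on)
    have "integrable ?M (\<lambda>z. \<delta>\<^sup>2 * indicator S z)"
      using S by (simp add: integrable_real_indicator less_top[symmetric])
    moreover have "(\<delta> * indicator S z)\<^sup>2 = \<delta>\<^sup>2 * indicator S z" for z
      by (auto simp: indicator_def)
    ultimately show ?thesis
      using S by (simp add: in_L2_def)
  qed
  have norm: "L2_norm Q (\<lambda>z. u_plus z - u_star z)
      \<le> L2_norm Q (\<lambda>z. u_rho z - u_star z) + \<delta> * sqrt (measure lebesgue S)"
    using L2_norm_le_add[OF in_L2_diff indicator in_L2_diff error] plus assms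
      L2_norm_indicator[of Q S \<delta>] S Q \<delta> by (simp add: fmeasurableD)
  have "measure lebesgue S \<le> measure lebesgue Q"
    using S S_leb Q by (intro measure_mono_fmeasurable)
  then have "\<delta> * sqrt (measure lebesgue S) \<le> \<delta> * sqrt (measure lebesgue Q)"
    using \<delta> by simp
  with norm have "L2_norm Q (\<lambda>z. u_plus z - u_star z)
      \<le> L2_norm Q (\<lambda>z. u_rho z - u_star z) + \<delta> * sqrt (measure lebesgue Q)"
    by simp
  with dichotomy error plus norm show ?thesis
    unfolding S_def by blast
qed

end
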